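(* Let $m,n\ge2$ and let $\theta$ be a permutation of $\{1,\dots,m\}\times\{1,\dots,n\}$. Then $\mathbb{F}_\theta^+$ satisfies the aperiodicity condition if and only if there is no pair of positive integers $(a,b)$ with $m^a=n^b$ for which there exists a bijection $\gamma:\mathbf m^a\to\mathbf n^b$ such that $$e_uf_v=f_{\gamma(u)}e_{\gamma^{-1}(v)}\quad\text{for all } u\in\mathbf m^a,\ v\in\mathbf n^b.$$
   Context: Semigroup. For a permutation $\theta$ of $\{1,\dots,m\}\times\{1,\dots,n\}$, $\mathbb{F}_\theta^+$ is the unital semigroup generated by $e_1,\dots,e_m,f_1,\dots,f_n$ subject only to the relations $e_if_j=f_{j'}e_{i'}$ whenever $\theta(i,j)=(i',j')$. A word with $k$ $e$'s and $l$ $f$'s has degree $d(w)=(k,l)$ (well defined). Every element of degree $(k,l)$ can be uniquely factored with any prescribed pattern of $k$ $e$'s and $l$ $f$'s. Write $\mathbf m=\{1,\dots,m\}$, $\mathbf n=\{1,\dots,n\}$; $\mathbf m^a$ and $\mathbf n^b$ are the sets of $a$-tuples and $b$-tuples (words); for $u=i_1\cdots i_a\in\mathbf m^a$ put $e_u=e_{i_1}\cdots e_{i_a}$, and similarly $f_v$ for $v\in\mathbf n^b$. Tails. A tail is an infinite word $\tau=e_{i_0}f_{j_0}e_{i_1}f_{j_1}\cdots$. Let $\tau_T=e_{i_0}f_{j_0}\cdots e_{i_{T-1}}f_{j_{T-1}}$. For integers $s,t\le 0$, choose $T>\max(|s|,|t|)$, factor $\tau_T=w_1w_2$ with $d(w_1)=(|s|,|t|)$,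 and write $w_2=e_iw'=f_jw''$; then $i_{s,t}:=i$ and $j_{s,t}:=j$ (independent of $T$). Symmetry. $H_\tau$ is the subgroup of all $(p,q)\in\mathbb Z^2$ for which there is an integer $T$ with $(i_{s+p,t+q},j_{s+p,t+q})=(i_{s,t},j_{s,t})$ for all $s,t\le T$ (with $T$ small enough that both sides are defined). The tail $\tau$ is aperiodic if $H_\tau=\{(0,0)\}$. The semigroup $\mathbb{F}_\theta^+$ satisfies the aperiodicity condition (is aperiodic) if there is an aperiodic tail; otherwise it is periodic. *)

theory Defs
  imports "HOL-Algebra.Group" "HOL-Combinatorics.Permutations"
begin

datatype letter = E nat | F nat

definition letters :: "nat \<Rightarrow> nat \<Rightarrow> letter set" where
  "letters m n = E ` {1..m} \<union> F ` {1..n}"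

inductive theta_step :: "nat \<Rightarrow> nat \<Rightarrow> (nat \<times> nat \<Rightarrow> nat \<times> nat) \<Rightarrow> letter list \<Rightarrow> letter list \<Rightarrow> bool"
  for m n \<theta> where
  "\<lbrakk>i \<in> {1..m}; j \<in> {1..n}; \<theta> (i, j) = (i', j')\<rbrakk>
    \<Longrightarrow> theta_step m n \<theta> (x @ [E i, F j] @ y) (x @ [F j', E i'] @ y)"

definition theta_cong ::
  "nat \<Rightarrow> nat \<Rightarrow> (nat \<times> nat \<Rightarrow> nat \<times> nat) \<Rightarrow> (letter list \<times> letter list) set" where
  "theta_cong m n \<theta> = {(x, y). equivclp (theta_step m n \<theta>) x y}"

text \<open>The unital semigroup with generators \<open>e\<^sub>1, \<dots>, e\<^sub>m, f\<^sub>1, \<dots>, f\<^sub>n\<close> and relations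
  \<open>e\<^sub>i f\<^sub>j = f\<^sub>j\<^sub>' e\<^sub>i\<^sub>'\<close>: words in the generators modulo the congruence generated by the relations.\<close>

definition theta_semigroup ::
  "nat \<Rightarrow> nat \<Rightarrow> (nat \<times> nat \<Rightarrow> nat \<times> nat) \<Rightarrow> letter list set monoid" where
  "theta_semigroup m n \<theta> =
    \<lparr>carrier = lists (letters m n) // theta_cong m n \<theta>,
     monoid.mult = (\<lambda>X Y. \<Union>x\<in>X. \<Union>y\<in>Y. theta_cong m n \<theta> `` {x @ y}),
     monoid.one = theta_cong m n \<theta> `` {[]}\<rparr>"

definition gen_e :: "nat \<Rightarrow> nat \<Rightarrow> (nat \<times> nat \<Rightarrow> nat \<times> nat) \<Rightarrow> nat \<Rightarrow> letter list set" where
  "gen_e m n \<theta> i = theta_cong m n \<theta> `` {[E i]}"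

definition gen_f :: "nat \<Rightarrow> nat \<Rightarrow> (nat \<times> nat \<Rightarrow> nat \<times> nat) \<Rightarrow> nat \<Rightarrow> letter list set" where
  "gen_f m n \<theta> j = theta_cong m n \<theta> `` {[F j]}"

definition words :: "nat \<Rightarrow> nat \<Rightarrow> nat list set" where
  "words k a = {u. length u = a \<and> set u \<subseteq> {1..k}}"

definition e_word :: "nat \<Rightarrow> nat \<Rightarrow> (nat \<times> nat \<Rightarrow> nat \<times> nat) \<Rightarrow> nat list \<Rightarrow> letter list set" where
  "e_word m n \<theta> u =
    foldr (\<lambda>i x. gen_e m n \<theta> i \<otimes>\<^bsub>theta_semigroup m n \<theta>\<^esub> x) u \<one>\<^bsub>theta_semigroup m n \<theta>\<^esub>"

definition f_word :: "nat \<Rightarrow> nat \<Rightarrow> (nat \<times> nat \<Rightarrow> nat \<times> nat) \<Rightarrow> nat list \<Rightarrow> letter list set" where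
  "f_word m n \<theta> v =
    foldr (\<lambda>j x. gen_f m n \<theta> j \<otimes>\<^bsub>theta_semigroup m n \<theta>\<^esub> x) v \<one>\<^bsub>theta_semigroup m n \<theta>\<^esub>"

definition word_degree :: "letter list \<Rightarrow> nat \<times> nat" where
  "word_degree w = (length (filter (\<lambda>c. \<exists>i. c = E i) w), length (filter (\<lambda>c. \<exists>j. c = F j) w))"

text \<open>The degree is constant on congruence classes (lemma \<open>degree_class\<close> below).\<close>

definition degree :: "letter list set \<Rightarrow> nat \<times> nat" where
  "degree X = (THE d. \<forall>w\<in>X. word_degree w = d)"

text \<open>A tail \<open>e\<^bsub>i\<^sub>0\<^esub> f\<^bsub>j\<^sub>0\<^esub> e\<^bsub>i\<^sub>1\<^esub> f\<^bsub>j\<^sub>1\<^esub> \<cdots>\<close> is given by its sequence of index pairs \<open>k \<mapsto> (i\<^sub>k, j\<^sub>k)\<close>.\<close>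

definition is_tail :: "nat \<Rightarrow> nat \<Rightarrow> (nat \<Rightarrow> nat \<times> nat) \<Rightarrow> bool" where
  "is_tail m n \<tau> \<longleftrightarrow> (\<forall>k. \<tau> k \<in> {1..m} \<times> {1..n})"

primrec tail_prefix ::
  "nat \<Rightarrow> nat \<Rightarrow> (nat \<times> nat \<Rightarrow> nat \<times> nat) \<Rightarrow> (nat \<Rightarrow> nat \<times> nat) \<Rightarrow> nat \<Rightarrow> letter list set" where
  "tail_prefix m n \<theta> \<tau> 0 = \<one>\<^bsub>theta_semigroup m n \<theta>\<^esub>"
| "tail_prefix m n \<theta> \<tau> (Suc T) =
    tail_prefix m n \<theta> \<tau> T \<otimes>\<^bsub>theta_semigroup m n \<theta>\<^esub>
      (gen_e m n \<theta> (fst (\<tau> T)) \<otimes>\<^bsub>theta_semigroup m n \<theta>\<^esub> gen_f m n \<theta> (snd (\<tau> T)))"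

text \<open>The pair \<open>(i\<^bsub>s,t\<^esub>, j\<^bsub>s,t\<^esub>)\<close>, meaningful for \<open>s, t \<le> 0\<close>; it does not depend on the choice of \<open>T\<close>.\<close>

definition tail_label ::
  "nat \<Rightarrow> nat \<Rightarrow> (nat \<times> nat \<Rightarrow> nat \<times> nat) \<Rightarrow> (nat \<Rightarrow> nat \<times> nat) \<Rightarrow> int \<Rightarrow> int \<Rightarrow> nat \<times> nat" where
  "tail_label m n \<theta> \<tau> s t = (THE ij.
    \<exists>T w\<^sub>1 w\<^sub>2 w' w''.
      int T > max \<bar>s\<bar> \<bar>t\<bar>
      \<and> w\<^sub>1 \<in> carrier (theta_semigroup m n \<theta>) \<and> w\<^sub>2 \<in> carrier (theta_semigroup m n \<theta>)
      \<and> w' \<in> carrier (theta_semigroup m n \<theta>) \<and> w'' \<in> carrier (theta_semigroup m n \<theta>)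
      \<and> tail_prefix m n \<theta> \<tau> T = w\<^sub>1 \<otimes>\<^bsub>theta_semigroup m n \<theta>\<^esub> w\<^sub>2
      \<and> degree w\<^sub>1 = (nat \<bar>s\<bar>, nat \<bar>t\<bar>)
      \<and> fst ij \<in> {1..m} \<and> snd ij \<in> {1..n}
      \<and> w\<^sub>2 = gen_e m n \<theta> (fst ij) \<otimes>\<^bsub>theta_semigroup m n \<theta>\<^esub> w'
      \<and> w\<^sub>2 = gen_f m n \<theta> (snd ij) \<otimes>\<^bsub>theta_semigroup m n \<theta>\<^esub> w'')"

text \<open>The conditions \<open>T \<le> 0\<close>, \<open>T + p \<le> 0\<close>, \<open>T + q \<le> 0\<close> say that both sides are defined
  for all \<open>s, t \<le> T\<close>.\<close>

definition tail_symmetry ::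
  "nat \<Rightarrow> nat \<Rightarrow> (nat \<times> nat \<Rightarrow> nat \<times> nat) \<Rightarrow> (nat \<Rightarrow> nat \<times> nat) \<Rightarrow> (int \<times> int) set" where
  "tail_symmetry m n \<theta> \<tau> = {(p, q).
    \<exists>T. T \<le> 0 \<and> T + p \<le> 0 \<and> T + q \<le> 0 \<and>
      (\<forall>s\<le>T. \<forall>t\<le>T. tail_label m n \<theta> \<tau> (s + p) (t + q) = tail_label m n \<theta> \<tau> s t)}"

definition aperiodic_tail ::
  "nat \<Rightarrow> nat \<Rightarrow> (nat \<times> nat \<Rightarrow> nat \<times> nat) \<Rightarrow> (nat \<Rightarrow> nat \<times> nat) \<Rightarrow> bool" where
  "aperiodic_tail m n \<theta> \<tau> \<longleftrightarrow> tail_symmetry m n \<theta> \<tau> = {(0, 0)}"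

definition aperiodicity_condition :: "nat \<Rightarrow> nat \<Rightarrow> (nat \<times> nat \<Rightarrow> nat \<times> nat) \<Rightarrow> bool" where
  "aperiodicity_condition m n \<theta> \<longleftrightarrow> (\<exists>\<tau>. is_tail m n \<tau> \<and> aperiodic_tail m n \<theta> \<tau>)"

lemma equiv_theta_cong: "equiv UNIV (theta_cong m n \<theta>)"
proof (rule equivI)
  show "refl (theta_cong m n \<theta>)"
    by (rule refl_onI) (simp add: theta_cong_def)
  show "sym (theta_cong m n \<theta>)"
    by (rule symI) (simp add: theta_cong_def equivclp_sym)
  show "trans (theta_cong m n \<theta>)"
    unfolding theta_cong_def by (rule transI) (blast dest: equivclp_trans)
qed simp

lemma theta_cong_append:
  assumes "(x, x') \<in> theta_cong m n \<theta>" "(y, y') \<in> theta_cong m n \<theta>"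
  shows "(x @ y, x' @ y') \<in> theta_cong m n \<theta>"
proof -
  have step_ctx: "theta_step m n \<theta> (u @ a @ v) (u @ b @ v)" if "theta_step m n \<theta> a b" for u v a b
    using that
  proof cases
    case (1 i j i' j' x y)
    then show ?thesis
      using theta_step.intros[of i m j n \<theta> i' j' "u @ x" "y @ v"] by simp
  qed
  have ctx: "equivclp (theta_step m n \<theta>) (u @ a @ v) (u @ b @ v)"
    if "equivclp (theta_step m n \<theta>) a b" for u v a b
    using that
  proof (induction rule: equivclp_induct)
    case (step y z)
    then show ?case
      by (meson equivclp_into_equivclp step_ctx)
  qed simp
  have "equivclp (theta_step m n \<theta>) (x @ y) (x' @ y)"
    using ctx[of x x' "[]" y] assms by (simp add: theta_cong_def)
  moreover have "equivclp (theta_step m n \<theta>) (x' @ y) (x' @ y')"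
    using ctx[of y y' x' "[]"] assms by (simp add: theta_cong_def)
  ultimately show ?thesis
    unfolding theta_cong_def by (blast dest: equivclp_trans)
qed

lemma mult_class:
  "theta_cong m n \<theta> `` {x} \<otimes>\<^bsub>theta_semigroup m n \<theta>\<^esub> theta_cong m n \<theta> `` {y}
    = theta_cong m n \<theta> `` {x @ y}"
proof -
  let ?r = "theta_cong m n \<theta>"
  have eq: "?r `` {x' @ y'} = ?r `` {x @ y}" if "x' \<in> ?r `` {x}" "y' \<in> ?r `` {y}" for x' y'
  proof -
    have "(x @ y, x' @ y') \<in> ?r"
      using that by (intro theta_cong_append) auto
    then show ?thesis
      by (rule equiv_class_eq[OF equiv_theta_cong, symmetric])
  qed
  have self: "x \<in> ?r `` {x}" "y \<in> ?r `` {y}"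
    by (rule equiv_class_self[OF equiv_theta_cong UNIV_I])+
  have "(\<Union>x'\<in>?r `` {x}. \<Union>y'\<in>?r `` {y}. ?r `` {x' @ y'})
      = (\<Union>x'\<in>?r `` {x}. \<Union>y'\<in>?r `` {y}. ?r `` {x @ y})"
    by (intro SUP_cong refl eq)
  also have "\<dots> = ?r `` {x @ y}"
    using self by (metis UN_constant empty_iff)
  finally show ?thesis
    by (simp add: theta_semigroup_def)
qed

lemma monoid_theta_semigroup: "monoid (theta_semigroup m n \<theta>)"
proof -
  let ?G = "theta_semigroup m n \<theta>" and ?r = "theta_cong m n \<theta>"
  have carr: "X \<in> carrier ?G \<longleftrightarrow> (\<exists>x\<in>lists (letters m n). X = ?r `` {x})" for X
    by (auto simp: theta_semigroup_def quotient_def)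
  have one: "\<one>\<^bsub>?G\<^esub> = ?r `` {[]}"
    by (simp add: theta_semigroup_def)
  show ?thesis
  proof (rule monoidI)
    fix X Y assume "X \<in> carrier ?G" "Y \<in> carrier ?G"
    then show "X \<otimes>\<^bsub>?G\<^esub> Y \<in> carrier ?G"
      unfolding carr by (metis mult_class append_in_lists_conv)
  next
    show "\<one>\<^bsub>?G\<^esub> \<in> carrier ?G"
      unfolding carr one by blast
  next
    fix X Y Z assume "X \<in> carrier ?G" "Y \<in> carrier ?G" "Z \<in> carrier ?G"
    then show "X \<otimes>\<^bsub>?G\<^esub> Y \<otimes>\<^bsub>?G\<^esub> Z = X \<otimes>\<^bsub>?G\<^esub> (Y \<otimes>\<^bsub>?G\<^esub> Z)"
      unfolding carr by (elim bexE) (simp only: mult_class append_assoc)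
  next
    fix X assume "X \<in> carrier ?G"
    then show "\<one>\<^bsub>?G\<^esub> \<otimes>\<^bsub>?G\<^esub> X = X" "X \<otimes>\<^bsub>?G\<^esub> \<one>\<^bsub>?G\<^esub> = X"
      unfolding carr one by (elim bexE, simp only: mult_class append.simps append_Nil2)+
  qed
qed

lemma degree_class: "degree (theta_cong m n \<theta> `` {w}) = word_degree w"
proof -
  have step_deg: "word_degree x = word_degree y" if "theta_step m n \<theta> x y" for x y
    using that by cases (simp add: word_degree_def)
  have inv: "word_degree x = word_degree w" if "equivclp (theta_step m n \<theta>) w x" for x
    using that
  proof (induction rule: equivclp_induct)
    case base
    show ?case by (rule refl)
  next
    case (step y z)
    then show ?case using step_deg by metis
  qed
  have self: "w \<in> theta_cong m n \<theta> `` {w}"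
    by (rule equiv_class_self[OF equiv_theta_cong UNIV_I])
  have const: "\<forall>x\<in>theta_cong m n \<theta> `` {w}. word_degree x = word_degree w"
    by (intro ballI inv) (simp add: theta_cong_def)
  show ?thesis
    unfolding degree_def
  proof (rule the_equality)
    show "d = word_degree w" if "\<forall>x\<in>theta_cong m n \<theta> `` {w}. word_degree x = d" for d
      using bspec[OF that self] by (rule sym)
  qed (rule const)
qed

end

theory Submission imports Defs "HOL-Library.Countable" begin

text \<open>The bridge between the two sides is the notion of a \<^emph>\<open>universal period\<close>: a vector \<open>(p, q)\<close>
such that in every element of the semigroup any two letters of the same kind whose positions
differ by \<open>(p, q)\<close> are equal. Here the position of a letter is the degree of the part in front
of it, and the element may be factored in different ways to exhibit the two letters.

\<^item> A universal period is a symmetry of every tail, since the labels of a tail are letters of its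
  prefixes (\<open>universal_period_tail_symmetry\<close>). Conversely, take a tail whose sequence of index pairs
  contains every finite sequence of pairs arbitrarily far out. Every element is an initial part of
  some \<open>e\<^sub>i f\<^sub>j e\<^sub>k f\<^sub>l \<cdots>\<close> and therefore occurs in this tail at positions \<open>(M, M)\<close> with \<open>M\<close> as large
  as desired, so that every symmetry of this one tail is a universal period
  (\<open>ex_tail_symmetry_universal_period\<close>). Hence the semigroup is aperiodic if and only if \<open>(0, 0)\<close> is the
  only universal period.

\<^item> For \<open>m, n \<ge> 2\<close> a nonzero universal period cannot have two entries of the same sign, because the
  letter at the origin and the letter at \<open>(p, q)\<close> can then be prescribed independently. So up to sign
  it is \<open>(a, - b)\<close> with \<open>a, b > 0\<close>. Suppose that \<open>e\<^sub>u f\<^sub>v = f\<^sub>v\<^sub>' e\<^sub>u\<^sub>'\<close> with \<open>u, u'\<close> of length \<open>a\<close> and \<open>v, v'\<close> of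
  length \<open>b\<close>, multiply by any \<open>f\<^sub>w\<close> on the right, and compare the \<open>b\<close> letters that follow \<open>e\<^sub>u\<close> with those
  that follow \<open>f\<^sub>v\<^sub>'\<close>: the period forces \<open>e\<^sub>u\<^sub>' f\<^sub>w\<close> to begin with \<open>f\<^sub>v\<close>, whatever \<open>w\<close> is
  (\<open>periodic_exchange\<close>). Therefore the leading \<open>f\<close>-block of \<open>e\<^sub>u f\<^sub>v\<close> depends on \<open>u\<close> only; this block is
  \<open>\<gamma>(u)\<close>. With the two kinds of letters interchanged, the same argument gives a map from \<open>f\<close>-blocks to
  \<open>e\<close>-blocks, and the two maps turn out to be inverse to each other (\<open>exchange_of_universal_period\<close>).

\<^item> Conversely, given \<open>\<gamma>\<close>, a computation with blocks shows that \<open>(a, - b)\<close> is a universal period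
  (\<open>universal_period_of_exchange\<close>).

All of this rests on unique factorization, which is derived from a function that moves the first
letter of a given kind to the front of a word and is compatible with the defining relations.\<close>

section \<open>Unique factorization\<close>


primrec is_e :: "letter \<Rightarrow> bool" where
  "is_e (E i) = True"
| "is_e (F j) = False"

abbreviation kinds :: "letter list \<Rightarrow> bool list" where
  "kinds w \<equiv> map is_e w"

text \<open>The degree is recorded as one count per kind, so that statements about the letters \<open>e\<close> and their
mirror images about the letters \<open>f\<close> are instances of one statement about a kind \<open>c\<close>.\<close>

abbreviation num :: "bool \<Rightarrow> letter list \<Rightarrow> nat" where
  "num c w \<equiv> count_list (kinds w) c"

lemma word_degree_num: "word_degree w = (num True w, num False w)"
proof (induction w)
  case (Cons a w)
  then show ?case by (cases a) (simp_all add: word_degree_def)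
qed (simp add: word_degree_def)

lemma count_list_replicate_bool:
  "count_list (replicate k c) d = (if c = d then k else 0)"
  by (induction k) auto

lemma equal_num_Nil:
  assumes "\<And>c. num c w = 0"
  shows "w = []"
proof (cases w)
  case (Cons a w')
  then show ?thesis using assms[of "is_e a"] by simp
qed

locale theta_words =
  fixes m n :: nat and \<theta> :: "nat \<times> nat \<Rightarrow> nat \<times> nat"
  assumes perm: "\<theta> permutes ({1..m} \<times> {1..n})"
begin

abbreviation W :: "letter list set" where
  "W \<equiv> lists (letters m n)"

definition cong :: "letter list \<Rightarrow> letter list \<Rightarrow> bool" (infix "\<approx>" 50) where
  "x \<approx> y \<longleftrightarrow> (x, y) \<in> theta_cong m n \<theta>"

abbreviation cls :: "letter list \<Rightarrow> letter list set" where
  "cls w \<equiv> theta_cong m n \<theta> `` {w}"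

lemma cong_refl [simp, intro]: "x \<approx> x"
  using equiv_class_self[OF equiv_theta_cong UNIV_I] by (auto simp: cong_def)

lemma cong_sym: "x \<approx> y \<Longrightarrow> y \<approx> x"
  unfolding cong_def using equiv_theta_cong by (meson equivE symE)

lemma cong_trans [trans]: "x \<approx> y \<Longrightarrow> y \<approx> z \<Longrightarrow> x \<approx> z"
  unfolding cong_def using equiv_theta_cong by (meson equivE transE)

lemma cls_eq_iff: "cls x = cls y \<longleftrightarrow> x \<approx> y"
  unfolding cong_def using eq_equiv_class_iff[OF equiv_theta_cong UNIV_I UNIV_I] by blast

lemma cong_append: "x \<approx> x' \<Longrightarrow> y \<approx> y' \<Longrightarrow> x @ y \<approx> x' @ y'"
  unfolding cong_def by (rule theta_cong_append)

lemma cong_appendL: "y \<approx> y' \<Longrightarrow> x @ y \<approx> x @ y'"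
  by (rule cong_append) auto

lemma cong_appendR: "x \<approx> x' \<Longrightarrow> x @ y \<approx> x' @ y"
  by (rule cong_append) auto

lemma cong_Cons: "y \<approx> y' \<Longrightarrow> a # y \<approx> a # y'"
  using cong_appendL[of y y' "[a]"] by simp

lemma num_cong: "x \<approx> y \<Longrightarrow> num c x = num c y"
  using degree_class[of m n \<theta> x] degree_class[of m n \<theta> y] cls_eq_iff[of x y]
  by (cases c) (auto simp: word_degree_num)

lemma theta_in: "i \<in> {1..m} \<Longrightarrow> j \<in> {1..n} \<Longrightarrow> \<theta> (i, j) \<in> {1..m} \<times> {1..n}"
  using permutes_in_image[OF perm, of "(i, j)"] by auto

lemma inv_theta_in: "i \<in> {1..m} \<Longrightarrow> j \<in> {1..n} \<Longrightarrow> inv_into UNIV \<theta> (i, j) \<in> {1..m} \<times> {1..n}"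
  using permutes_in_image[OF permutes_inv[OF perm], of "(i, j)"] by auto

lemma E_letters [simp]: "E i \<in> letters m n \<longleftrightarrow> i \<in> {1..m}"
  and F_letters [simp]: "F j \<in> letters m n \<longleftrightarrow> j \<in> {1..n}"
  by (auto simp: letters_def)

lemma W_step: "theta_step m n \<theta> x y \<Longrightarrow> x \<in> W \<longleftrightarrow> y \<in> W"
  by (erule theta_step.cases) (use theta_in in fastforce)

lemma W_cong:
  assumes "x \<approx> y"
  shows "x \<in> W \<longleftrightarrow> y \<in> W"
proof -
  have "equivclp (theta_step m n \<theta>) x y"
    using assms by (simp add: cong_def theta_cong_def)
  then show ?thesis
  proof (induction rule: equivclp_induct)
    case (step y z)
    then show ?case using W_step by metis
  qed simp
qed

text \<open>The pair \<open>flip a b = (b', a')\<close> is the result of interchanging two adjacent letters of different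
kinds by the relation \<open>a b = b' a'\<close>. On letters of the same kind the value is a dummy.\<close>

fun flip :: "letter \<Rightarrow> letter \<Rightarrow> letter \<times> letter" where
  "flip (E i) (F j) = (F (snd (\<theta> (i, j))), E (fst (\<theta> (i, j))))"
| "flip (F j) (E i) = (E (fst (inv_into UNIV \<theta> (i, j))), F (snd (inv_into UNIV \<theta> (i, j))))"
| "flip a b = (a, b)"

lemma flip_cong:
  assumes "is_e a \<noteq> is_e b" "a \<in> letters m n" "b \<in> letters m n"
  obtains a' b' where "flip a b = (b', a')" "is_e a' = is_e a" "is_e b' = is_e b"
    "a' \<in> letters m n" "b' \<in> letters m n" "[a, b] \<approx> [b', a']"
proof -
  have step: "[E i, F j] \<approx> [F j', E i']"
    if "i \<in> {1..m}" "j \<in> {1..n}" "\<theta> (i, j) = (i', j')" for i j i' j'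
    using theta_step.intros[of i m j n \<theta> i' j' "[]" "[]"] that unfolding cong_def theta_cong_def by auto
  show ?thesis
  proof (cases a)
    case (E i)
    then obtain j where b: "b = F j" using assms by (cases b) auto
    obtain i' j' where ij: "\<theta> (i, j) = (i', j')" by force
    show ?thesis
      using that[of "F j'" "E i'"] theta_in[of i j] step[of i j i' j'] assms E b ij by auto
  next
    case (F j)
    then obtain i where b: "b = E i" using assms by (cases b) auto
    obtain i' j' where ij: "inv_into UNIV \<theta> (i, j) = (i', j')" by force
    then have "\<theta> (i', j') = (i, j)"
      using permutes_inverses(1)[OF perm] by metis
    then show ?thesis
      using that[of "E i'" "F j'"] inv_theta_in[of i j] cong_sym[OF step[of i' j' i j]] assms F b ij
      by auto
  qed
qed

text \<open>The first letter of kind \<open>c\<close> is moved to the front of the word by interchanging it with all the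
letters before it; the result is that letter, as changed on the way, and the remaining word.\<close>

primrec pull :: "bool \<Rightarrow> letter list \<Rightarrow> (letter \<times> letter list) option" where
  "pull c [] = None"
| "pull c (a # w) =
    (if is_e a = c then Some (a, w)
     else map_option (\<lambda>(b, w'). (fst (flip a b), snd (flip a b) # w')) (pull c w))"

abbreviation pull_cls :: "bool \<Rightarrow> letter list \<Rightarrow> (letter \<times> letter list set) option" where
  "pull_cls c w \<equiv> map_option (map_prod id cls) (pull c w)"

lemma pull_cls_Cons:
  assumes "pull_cls c x = pull_cls c y" "x \<approx> y"
  shows "pull_cls c (a # x) = pull_cls c (a # y)"
proof (cases "is_e a = c")
  case True
  then show ?thesis using cong_Cons[OF assms(2), of a] assms(2) by (simp add: cls_eq_iff)
next
  case False
  then show ?thesis using assms(1)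
    by (cases "pull c x"; cases "pull c y") (auto simp: cls_eq_iff cong_Cons)
qed

text \<open>Up to congruence of the remaining word, \<open>pull\<close> does not see an application of a relation: at the
front of the word this says that \<open>\<theta>\<inverse>\<close> undoes \<open>\<theta>\<close>, and further letters in front act on
both sides in the same way.\<close>

lemma pull_cls_step:
  assumes "theta_step m n \<theta> x y"
  shows "pull_cls c x = pull_cls c y"
  using assms
proof cases
  case (1 i j i' j' p q)
  have inv: "inv_into UNIV \<theta> (i', j') = (i, j)"
    using 1 permutes_inverses(2)[OF perm] by metis
  have "theta_step m n \<theta> (r @ [E i, F j] @ q) (r @ [F j', E i'] @ q)" for r
    using 1 by (intro theta_step.intros)
  then have cong: "r @ [E i, F j] @ q \<approx> r @ [F j', E i'] @ q" for r
    unfolding cong_def theta_cong_def by blast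
  have "pull_cls c (p @ [E i, F j] @ q) = pull_cls c (p @ [F j', E i'] @ q)"
  proof (induction p)
    case Nil
    then show ?case using inv 1 by (cases c) simp_all
  next
    case (Cons a p)
    show ?case using pull_cls_Cons[OF Cons.IH cong, of a] by (simp only: append_Cons)
  qed
  then show ?thesis using 1 by simp
qed

lemma pull_cls_cong:
  assumes "x \<approx> y"
  shows "pull_cls c x = pull_cls c y"
proof -
  have "equivclp (theta_step m n \<theta>) x y"
    using assms by (simp add: cong_def theta_cong_def)
  then show ?thesis
  proof (induction rule: equivclp_induct)
    case (step y z)
    then show ?case using pull_cls_step by metis
  qed simp
qed

text \<open>This is the core of unique factorization: pulling out the first letter of the kind of \<open>a\<close> recovers
both \<open>a\<close> and the class of the remaining word from the class of the product.\<close>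

lemma cong_ConsD:
  assumes "a # x \<approx> b # y" "is_e a = is_e b"
  shows "a = b" "x \<approx> y"
  using pull_cls_cong[OF assms(1), of "is_e a"] assms(2) by (simp_all add: cls_eq_iff)

lemma cong_same_kinds:
  assumes "x \<approx> y" "kinds x = kinds y"
  shows "x = y"
  using assms
proof (induction x arbitrary: y)
  case (Cons a x)
  then obtain b y' where y: "y = b # y'" "is_e a = is_e b" "kinds x = kinds y'" by (cases y) auto
  then show ?case using cong_ConsD[of a x b y'] Cons by auto
qed simp

lemma to_front:
  assumes "w \<in> W" "num c w > 0"
  obtains a u where "a # u \<in> W" "is_e a = c" "w \<approx> a # u"
  using assms
proof (induction w arbitrary: thesis rule: list.induct)
  case (Cons a w)
  show ?case
  proof (cases "is_e a = c")
    case True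
    then show ?thesis using Cons.prems by blast
  next
    case False
    then obtain b u where bu: "b # u \<in> W" "is_e b = c" "w \<approx> b # u"
      using Cons by auto
    have "is_e a \<noteq> is_e b" "a \<in> letters m n" "b \<in> letters m n"
      using bu False Cons.prems by auto
    from flip_cong[OF this] obtain a' b' where f: "is_e b' = is_e b" "a' \<in> letters m n"
      "b' \<in> letters m n" "[a, b] \<approx> [b', a']"
      by metis
    have "a # w \<approx> [a, b] @ u" using cong_Cons[OF bu(3)] by simp
    also have "\<dots> \<approx> [b', a'] @ u" by (rule cong_appendR[OF f(4)])
    finally show ?thesis using Cons.prems(1)[of b' "a' # u"] bu f by simp
  qed
qed simp

text \<open>Existence of a factorization with a prescribed pattern; uniqueness is \<open>cong_same_kinds\<close>.\<close>

lemma factor_pattern: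
  assumes "w \<in> W" "\<And>c. count_list ps c = num c w"
  obtains w' where "w' \<in> W" "w \<approx> w'" "kinds w' = ps"
  using assms
proof (induction ps arbitrary: w thesis rule: list.induct)
  case Nil
  then show ?case using equal_num_Nil[of w] by auto
next
  case (Cons c ps)
  then have "num c w > 0"
    by (metis count_list.simps(2) zero_less_Suc Suc_eq_plus1)
  then obtain a u where au: "a # u \<in> W" "is_e a = c" "w \<approx> a # u"
    using to_front Cons.prems(2) by metis
  have "count_list ps d = num d u" for d
    using Cons.prems(3)[of d] num_cong[OF au(3), of d] au(2) by (simp split: if_splits)
  then obtain u' where u': "u' \<in> W" "u \<approx> u'" "kinds u' = ps"
    using Cons.IH au(1) by (metis Cons_in_lists_iff)
  show ?case
    using Cons.prems(1)[of "a # u'"] u' au cong_trans[OF au(3) cong_Cons[OF u'(2)]] by simp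
qed

lemma factor_pattern_append:
  assumes "w \<in> W" "\<And>c. count_list ps c + count_list qs c = num c w"
  obtains u v where "u \<in> W" "v \<in> W" "w \<approx> u @ v" "kinds u = ps" "kinds v = qs"
proof -
  obtain w' where w': "w' \<in> W" "w \<approx> w'" "kinds w' = ps @ qs"
    using factor_pattern[OF assms(1), of "ps @ qs"] assms(2) by auto
  then obtain u v where uv: "w' = u @ v" "ps = kinds u" "qs = kinds v"
    by (auto simp: map_eq_append_conv)
  then show ?thesis using that w' by auto
qed

lemma factor_prefix:
  assumes "w \<in> W" "\<And>c. d c \<le> num c w"
  shows "\<exists>u\<in>W. \<exists>v\<in>W. w \<approx> u @ v \<and> (\<forall>c. num c u = d c)"
proof -
  let ?p = "\<lambda>f. replicate (f True) True @ replicate (f False) False"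
  have p: "count_list (?p f) c = f c" for f :: "bool \<Rightarrow> nat" and c
    by (cases c) (simp_all add: count_list_replicate_bool)
  have split: "count_list (?p d) c + count_list (?p (\<lambda>c. num c w - d c)) c = num c w" for c
    using assms(2)[of c] p[of d] p[of "\<lambda>c. num c w - d c"]
    by (simp only: le_add_diff_inverse)
  obtain u v where uv: "u \<in> W" "v \<in> W" "w \<approx> u @ v" "kinds u = ?p d"
    "kinds v = ?p (\<lambda>c. num c w - d c)"
    by (rule factor_pattern_append[OF assms(1) split])
  have "num c u = d c" for c
    unfolding uv(4) by (rule p)
  then show ?thesis using uv by blast
qed

lemma cong_cancel:
  assumes "u @ v \<approx> u' @ v'" "u \<in> W" "u' \<in> W" "\<And>c. num c u = num c u'"
  shows "u \<approx> u'" "v \<approx> v'"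
proof -
  have "u \<approx> u' \<and> v \<approx> v'" using assms
  proof (induction u arbitrary: u')
    case Nil
    then show ?case using equal_num_Nil[of u'] by auto
  next
    case (Cons a r)
    have "num (is_e a) u' > 0" using Cons.prems(4)[of "is_e a", symmetric] by simp
    then obtain b r' where br: "b # r' \<in> W" "is_e b = is_e a" "u' \<approx> b # r'"
      using to_front Cons.prems(3) by metis
    have "a # (r @ v) \<approx> b # (r' @ v')"
      using cong_trans[OF Cons.prems(1) cong_appendR[OF br(3)]] by simp
    note ab = cong_ConsD[OF this br(2)[symmetric]]
    have "num c r = num c r'" for c
      using Cons.prems(4)[of c] num_cong[OF br(3), of c] ab by (simp split: if_splits)
    then have "r \<approx> r' \<and> v \<approx> v'" using Cons.IH[OF ab(2)] Cons.prems(2) br(1) by simp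
    then show ?case using ab cong_Cons cong_sym[OF br(3)] cong_trans by blast
  qed
  then show "u \<approx> u'" "v \<approx> v'" by auto
qed

section \<open>Universal periods\<close>

text \<open>A label of a tail is a pair consisting of an \<open>e\<close> and an \<open>f\<close>. Comparing single letters of the
same kind amounts to comparing such pairs: after multiplication by further letters on the right
both labels exist, and the letters already present keep their positions.\<close>

definition universal_period :: "int \<Rightarrow> int \<Rightarrow> bool" where
  "universal_period p q \<longleftrightarrow> (\<forall>P c R Q c' R'.
    P @ c # R \<in> W \<longrightarrow> P @ c # R \<approx> Q @ c' # R' \<longrightarrow> is_e c = is_e c' \<longrightarrow>
    int (num True P) = int (num True Q) + p \<longrightarrow>
    int (num False P) = int (num False Q) + q \<longrightarrow> c = c')"

lemma universal_periodD:
  assumes "universal_period p q" "P @ c # R \<approx> Q @ c' # R'" "P @ c # R \<in> W" "is_e c = is_e c'"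
    "int (num True P) = int (num True Q) + p" "int (num False P) = int (num False Q) + q"
  shows "c = c'"
  using assms unfolding universal_period_def by blast

lemma universal_period_uminus:
  assumes "universal_period p q"
  shows "universal_period (- p) (- q)"
  unfolding universal_period_def
proof (intro allI impI)
  fix P c R Q c' R'
  assume *: "P @ c # R \<in> W" "P @ c # R \<approx> Q @ c' # R'" "is_e c = is_e c'"
    "int (num True P) = int (num True Q) + - p" "int (num False P) = int (num False Q) + - q"
  then show "c = c'"
    using universal_periodD[OF assms cong_sym[OF *(2)]] W_cong[OF *(2)] by simp
qed

text \<open>In the element \<open>e\<^sub>1\<^sup>p f\<^sub>1\<^sup>q e\<^sub>2\<close> (if \<open>p > 0\<close>) or \<open>f\<^sub>1\<^sup>q f\<^sub>2\<close> (if \<open>p = 0\<close>), the last letter is at position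
\<open>(p, q)\<close> and differs from the first one, which is at the origin.\<close>

lemma universal_period_nonneg:
  assumes "universal_period p q" "p \<ge> 0" "q \<ge> 0" "m \<ge> 2" "n \<ge> 2"
  shows "p = 0 \<and> q = 0"
proof (rule ccontr)
  assume ne: "\<not> (p = 0 \<and> q = 0)"
  let ?P = "replicate (nat p) (E 1) @ replicate (nat q) (F 1)"
  have W: "?P \<in> W" using assms by auto
  have num: "num True ?P = nat p" "num False ?P = nat q"
    by (simp_all add: count_list_replicate_bool)
  show False
  proof (cases "p = 0")
    case True
    then obtain l where l: "nat q = Suc l" using ne assms(3) by (cases "nat q") auto
    then have "q = 1 + int l" by simp
    moreover have "?P @ F 2 # [] = [] @ F 1 # replicate l (F 1) @ [F 2]" using True l by simp
    then have "?P @ F 2 # [] \<approx> [] @ F 1 # replicate l (F 1) @ [F 2]" by (metis cong_refl)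
    ultimately show False
      using universal_periodD[OF assms(1), of ?P "F 2" "[]" "[]" "F 1" "replicate l (F 1) @ [F 2]"] True W num l assms(5)
      by simp
  next
    case False
    then obtain k where k: "nat p = Suc k" using assms(2) by (cases "nat p") auto
    then have "p = 1 + int k" by simp
    moreover have "?P @ E 2 # [] = [] @ E 1 # replicate k (E 1) @ replicate (nat q) (F 1) @ [E 2]"
      using k by simp
    then have "?P @ E 2 # [] \<approx> [] @ E 1 # replicate k (E 1) @ replicate (nat q) (F 1) @ [E 2]"
      by (metis cong_refl)
    ultimately show False
      using universal_periodD[OF assms(1), of ?P "E 2" "[]" "[]" "E 1"
          "replicate k (E 1) @ replicate (nat q) (F 1) @ [E 2]"] W num k assms(3,4)
      by simp
  qed
qed


section \<open>Exchange of blocks\<close>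

definition block :: "bool \<Rightarrow> nat \<Rightarrow> letter list set" where
  "block c k = {A \<in> W. kinds A = replicate k c}"

lemma factor_blocks:
  assumes "A \<in> block c k" "B \<in> block (\<not> c) l"
  obtains B' A' where "B' \<in> block (\<not> c) l" "A' \<in> block c k" "A @ B \<approx> B' @ A'"
proof -
  have W: "A @ B \<in> W" and num: "count_list (replicate l (\<not> c)) d + count_list (replicate k c) d
      = num d (A @ B)" for d
    using assms by (auto simp: block_def)
  obtain B' A' where "B' \<in> W" "A' \<in> W" "A @ B \<approx> B' @ A'" "kinds B' = replicate l (\<not> c)"
    "kinds A' = replicate k c"
    by (rule factor_pattern_append[OF W num])
  then show ?thesis using that by (simp add: block_def)
qed

lemma leading_block_unique:
  assumes "B @ A \<approx> B' @ A'" "B \<in> block c l" "B' \<in> block c l" "A \<in> block d k" "A' \<in> block d k"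
  shows "B = B'"
proof -
  have k: "kinds B = kinds B'" "kinds A = kinds A'" using assms by (simp_all add: block_def)
  then have "B @ A = B' @ A'" using cong_same_kinds[OF assms(1)] by simp
  moreover have "length B = length B'" using k(1) by (metis length_map)
  ultimately show "B = B'" by simp
qed

text \<open>In \<open>A B1 B2 = B A1 B2\<close>, the letters of \<open>B1\<close> are at the positions starting at the degree of \<open>A\<close>,
and the letters of the leading block of \<open>A1 B2\<close> are at the positions starting at the degree of \<open>B\<close>.
As these degrees differ by a universal period, the leading block is \<open>B1\<close>, for every choice of \<open>B2\<close>.\<close>

lemma periodic_exchange:
  assumes "universal_period p q" "A @ B1 \<approx> B @ A1"
    and "A \<in> block c k" "A1 \<in> block c k"
    and "B \<in> block (\<not> c) l" "B1 \<in> block (\<not> c) l" "B2 \<in> block (\<not> c) l"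
    and "int (num True A) = int (num True B) + p" "int (num False A) = int (num False B) + q"
  obtains A2 where "A2 \<in> block c k" "A1 @ B2 \<approx> B1 @ A2"
proof -
  obtain B1' A2 where *: "B1' \<in> block (\<not> c) l" "A2 \<in> block c k" "A1 @ B2 \<approx> B1' @ A2"
    by (rule factor_blocks[OF assms(4,7)])
  have len: "length B1 = l" "length B1' = l"
    using assms(6) * unfolding block_def by (metis (mono_tags) mem_Collect_eq length_map length_replicate)+
  have "A @ B1 @ B2 \<approx> B @ A1 @ B2"
    using cong_appendR[OF assms(2), of B2] by simp
  also have "\<dots> \<approx> B @ B1' @ A2"
    by (rule cong_appendL[OF *(3)])
  finally have w: "A @ B1 @ B2 \<approx> B @ B1' @ A2" .
  have W: "A @ B1 @ B2 \<in> W" using assms(3,6,7) by (simp add: block_def)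
  have "B1 = B1'"
  proof (rule nth_equalityI)
    fix i assume "i < length B1"
    then have i: "i < length B1" "i < length B1'" using len by auto
    have split: "X @ Y @ Z = (X @ take i Y) @ Y ! i # drop (Suc i) Y @ Z"
      if "i < length Y" for X Y Z :: "letter list"
      using id_take_nth_drop[OF that] by (metis append.assoc append_Cons)
    have kinds: "kinds (take i Y) = replicate i (\<not> c)" "is_e (Y ! i) = (\<not> c)"
      if "Y \<in> block (\<not> c) l" "i < length Y" for Y
    proof -
      have k: "kinds Y = replicate l (\<not> c)" using that by (simp add: block_def)
      have l: "i < l" using k that by (metis length_map length_replicate)
      show "kinds (take i Y) = replicate i (\<not> c)" using k l by (simp add: take_map [symmetric])
      show "is_e (Y ! i) = (\<not> c)" using k l that by (metis nth_map nth_replicate)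
    qed
    show "B1 ! i = B1' ! i"
      by (rule universal_periodD[OF assms(1) w[unfolded split[OF i(1)] split[OF i(2)]]
            W[unfolded split[OF i(1)]]])
        (use kinds[OF assms(6) i(1)] kinds[OF *(1) i(2)] assms(8,9) in simp_all)
  qed (use len in simp)
  then show ?thesis using that * by blast
qed

text \<open>The map \<open>h c\<close> takes a block of kind \<open>c\<close> to the leading block of the other kind in its products; so
\<open>h True\<close> is \<open>\<gamma>\<close> and \<open>h False\<close> is its inverse. Treating both maps as one function of the kind lets
each step be applied in both directions.\<close>

lemma exchange_of_universal_period:
  fixes a b :: nat
  assumes "universal_period (int a) (- int b)" "m \<ge> 1" "n \<ge> 1"
  defines "blk \<equiv> \<lambda>c. block c (if c then a else b)"
  shows "\<exists>h. \<forall>c. (\<forall>A\<in>blk c. h c A \<in> blk (\<not> c) \<and> h (\<not> c) (h c A) = A) \<and>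
    (\<forall>A\<in>blk c. \<forall>B\<in>blk (\<not> c). A @ B \<approx> h c A @ h (\<not> c) B)"
proof -
  have num: "num d A = (if c = d then if c then a else b else 0)" if "A \<in> blk c" for A c d
    using that by (auto simp: blk_def block_def count_list_replicate_bool split: if_splits)
  have exch: "\<exists>A2\<in>blk c. A1 @ B2 \<approx> B1 @ A2"
    if "A @ B1 \<approx> B @ A1" "A \<in> blk c" "A1 \<in> blk c" "B \<in> blk (\<not> c)" "B1 \<in> blk (\<not> c)" "B2 \<in> blk (\<not> c)"
    for A A1 B B1 B2 c
  proof -
    let ?s = "if c then 1 else - 1 :: int"
    have up: "universal_period (?s * int a) (?s * - int b)"
      using assms(1) universal_period_uminus[OF assms(1)] by simp
    have "int (num True A) = int (num True B) + ?s * int a"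
      "int (num False A) = int (num False B) + ?s * - int b"
      using num[OF that(2)] num[OF that(4)] by auto
    then show ?thesis
      using periodic_exchange[OF up that(1) that(2-6)[unfolded blk_def]] unfolding blk_def by blast
  qed
  (* Any factorization B0 A = A0 B exhibits A as the trailing block of an exchange, and the
     block B found there serves for all products A B2. *)
  have ex: "\<exists>B\<in>blk (\<not> c). \<forall>B2\<in>blk (\<not> c). \<exists>A2\<in>blk c. A @ B2 \<approx> B @ A2" if A: "A \<in> blk c" for c A
  proof -
    let ?B0 = "replicate (if c then b else a) (if c then F 1 else E 1)"
    have B0: "?B0 \<in> block (\<not> c) (if \<not> c then a else b)"
      using assms(2,3) by (auto simp: block_def)
    have A': "A \<in> block (\<not> \<not> c) (if c then a else b)"
      using A by (simp add: blk_def)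
    obtain A0 B where AB: "A0 \<in> block (\<not> \<not> c) (if c then a else b)"
      "B \<in> block (\<not> c) (if \<not> c then a else b)" "?B0 @ A \<approx> A0 @ B"
      by (rule factor_blocks[OF B0 A'])
    have "\<forall>B2\<in>blk (\<not> c). \<exists>A2\<in>blk c. A @ B2 \<approx> B @ A2"
      using exch[OF cong_sym[OF AB(3)]] AB(1,2) A B0 by (simp add: blk_def)
    moreover have "B \<in> blk (\<not> c)" using AB(2) by (simp add: blk_def)
    ultimately show ?thesis by blast
  qed
  have "\<forall>c A. \<exists>B. A \<in> blk c \<longrightarrow> B \<in> blk (\<not> c) \<and> (\<forall>B2\<in>blk (\<not> c). \<exists>A2\<in>blk c. A @ B2 \<approx> B @ A2)"
    using ex by blast
  then obtain h where h: "\<And>c A. A \<in> blk c \<Longrightarrow> h c A \<in> blk (\<not> c)"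
    "\<And>c A B2. A \<in> blk c \<Longrightarrow> B2 \<in> blk (\<not> c) \<Longrightarrow> \<exists>A2\<in>blk c. A @ B2 \<approx> h c A @ A2"
    by metis
  have h_eq: "h c A = B"
    if eq: "A @ B2 \<approx> B @ A2" and mem: "A \<in> blk c" "B2 \<in> blk (\<not> c)" "B \<in> blk (\<not> c)" "A2 \<in> blk c" for c A B A2 B2
  proof -
    obtain A2' where A2': "A2' \<in> blk c" "A @ B2 \<approx> h c A @ A2'" using h(2)[OF mem(1,2)] by blast
    have "h c A @ A2' \<approx> B @ A2" using cong_trans[OF cong_sym[OF A2'(2)] eq] .
    then show ?thesis
      using leading_block_unique h(1)[OF mem(1)] mem A2'(1) unfolding blk_def by blast
  qed
  (* The exchange A B = B' A' determines h c A at once. Read backwards, and with a further factor on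
     the right, it also shows that h interchanges B and A'. *)
  have key: "B' = h c A \<and> A' = h (\<not> c) B \<and> h c A' = B"
    if AB: "A @ B \<approx> B' @ A'" "A \<in> blk c" "B \<in> blk (\<not> c)" "B' \<in> blk (\<not> c)" "A' \<in> blk c" for A B A' B' c
  proof (intro conjI)
    show "B' = h c A" using h_eq[OF AB(1,2,3,4,5)] by simp
    obtain B2 where "B2 \<in> blk (\<not> c)" "B @ A \<approx> A' @ B2"
      using exch[of B' A' A B "\<not> c" A] cong_sym[OF AB(1)] AB by auto
    then show "A' = h (\<not> c) B" using h_eq[of B A A' B2 "\<not> c"] AB by simp
    obtain A2 where "A2 \<in> blk c" "A' @ B \<approx> B @ A2"
      using exch[of A B B' A' c B] AB by auto
    then show "h c A' = B" using h_eq[of A' B B A2 c] AB by simp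
  qed
  have all: "A @ B \<approx> h c A @ h (\<not> c) B" "h c (h (\<not> c) B) = B"
    if "A \<in> blk c" "B \<in> blk (\<not> c)" for A B c
    using h(2)[OF that] key[of A B "h c A" _ c] h(1) that by auto
  have "h (\<not> c) (h c A) = A" if "A \<in> blk c" for c A
    using all(2)[of "h c A" "\<not> c" A] h(1)[OF that] that by simp
  then show ?thesis using h(1) all(1) by (intro exI[of _ h]) blast
qed

primrec idx :: "letter \<Rightarrow> nat" where
  "idx (E i) = i"
| "idx (F j) = j"

lemma block_eq_image_words:
  assumes kind: "\<And>i. is_e (G i) = c" and inv: "\<And>x. is_e x = c \<Longrightarrow> G (idx x) = x"
    and letter: "\<And>i. G i \<in> letters m n \<longleftrightarrow> i \<in> {1..r}"
  shows "block c k = map G ` words r k"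
proof
  show "block c k \<subseteq> map G ` words r k"
  proof
    fix A assume "A \<in> block c k"
    then have *: "A \<in> W" "kinds A = replicate k c" by (auto simp: block_def)
    have "is_e x = c" if "x \<in> set A" for x
      using that *(2) by (metis in_set_replicate image_eqI set_map)
    then have G: "G (idx x) = x" if "x \<in> set A" for x using that inv by blast
    then have "A = map G (map idx A)" by (simp add: map_idI)
    moreover have "map idx A \<in> words r k"
    proof -
      have "length A = k" using *(2) by (metis length_map length_replicate)
      moreover have "idx x \<in> {1..r}" if "x \<in> set A" for x
        using G[OF that] *(1) that letter by (metis in_listsD)
      ultimately show ?thesis by (auto simp: words_def)
    qed
    ultimately show "A \<in> map G ` words r k" by blast
  qed
  show "map G ` words r k \<subseteq> block c k"
    by (auto simp: block_def words_def map_replicate_const comp_def subset_iff kind letter)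
qed

lemma block_E: "block True k = map E ` words m k"
proof (rule block_eq_image_words)
  show "E (idx x) = x" if "is_e x = True" for x using that by (cases x) simp_all
qed simp_all

lemma block_F: "block False k = map F ` words n k"
proof (rule block_eq_image_words)
  show "F (idx x) = x" if "is_e x = False" for x using that by (cases x) simp_all
qed simp_all

definition exchange :: "nat \<Rightarrow> nat \<Rightarrow> (nat list \<Rightarrow> nat list) \<Rightarrow> bool" where
  "exchange a b \<gamma> \<longleftrightarrow> bij_betw \<gamma> (words m a) (words n b) \<and>
    (\<forall>u\<in>words m a. \<forall>v\<in>words n b.
      map E u @ map F v \<approx> map F (\<gamma> u) @ map E (inv_into (words m a) \<gamma> v))"

lemma ex_exchange:
  assumes "universal_period (int a) (- int b)" "m \<ge> 1" "n \<ge> 1"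
  shows "\<exists>\<gamma>. exchange a b \<gamma>"
proof -
  obtain h where h: "\<forall>c.
      (\<forall>A\<in>block c (if c then a else b). h c A \<in> block (\<not> c) (if \<not> c then a else b) \<and>
        h (\<not> c) (h c A) = A) \<and>
      (\<forall>A\<in>block c (if c then a else b). \<forall>B\<in>block (\<not> c) (if \<not> c then a else b).
        A @ B \<approx> h c A @ h (\<not> c) B)"
    using exchange_of_universal_period[OF assms] by blast
  have hE: "A \<in> block True a \<Longrightarrow> h True A \<in> block False b"
    "A \<in> block True a \<Longrightarrow> h False (h True A) = A"
    "A \<in> block True a \<Longrightarrow> B \<in> block False b \<Longrightarrow> A @ B \<approx> h True A @ h False B" for A B
    using spec[OF h, of True] by simp_all
  have hF: "A \<in> block False b \<Longrightarrow> h False A \<in> block True a"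
    "A \<in> block False b \<Longrightarrow> h True (h False A) = A" for A
    using spec[OF h, of False] by simp_all
  define \<gamma> where "\<gamma> = (\<lambda>u. map idx (h True (map E u)))"
  define \<delta> where "\<delta> = (\<lambda>v. map idx (h False (map F v)))"
  have idx: "map idx (map E u) = u" "map idx (map F u) = u" for u
    by (simp_all add: comp_def)
  have g: "\<gamma> u \<in> words n b" "map F (\<gamma> u) = h True (map E u)" if "u \<in> words m a" for u
    using hE(1)[of "map E u"] that idx unfolding block_E block_F \<gamma>_def by fastforce+
  have d: "\<delta> v \<in> words m a" "map E (\<delta> v) = h False (map F v)" if "v \<in> words n b" for v
    using hF(1)[of "map F v"] that idx unfolding block_E block_F \<delta>_def by fastforce+
  have dg: "\<delta> (\<gamma> u) = u" if "u \<in> words m a" for u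
    using hE(2)[of "map E u"] that g(2)[OF that] idx unfolding \<delta>_def block_E by simp
  have gd: "\<gamma> (\<delta> v) = v" if "v \<in> words n b" for v
    using hF(2)[of "map F v"] that d(2)[OF that] idx unfolding \<gamma>_def block_F by simp
  have bij: "bij_betw \<gamma> (words m a) (words n b)"
    using g(1) d(1) dg gd by (intro bij_betw_byWitness[where f' = \<delta>]) auto
  have "inv_into (words m a) \<gamma> v = \<delta> v" if "v \<in> words n b" for v
    using inv_into_f_f[OF bij_betw_imp_inj_on[OF bij] d(1)[OF that]] gd[OF that] by simp
  then show ?thesis
    using bij hE(3) g(2) d(2) unfolding exchange_def block_E block_F
    by (intro exI[of _ \<gamma>]) simp
qed

lemma head_eq:
  assumes "c # x \<approx> X @ y" "X \<noteq> []" "is_e (hd X) = is_e c"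
  shows "c = hd X"
  using assms by (cases X) (auto dest: cong_ConsD(1))

text \<open>After cancellation of a common prefix, the two letters to be compared are the first letters of \<open>x\<close>
and \<open>y\<close> in an equation \<open>e\<^sub>u x = f\<^sub>v y\<close>. Multiplying by a suitable element on the right, one may
factor \<open>x = f\<^sub>v\<^sub>1 e\<^sub>u\<^sub>2 f\<^sub>v\<^sub>3 \<cdots>\<close>. The exchange relation gives \<open>v = \<gamma>(u)\<close> and
\<open>y = e\<^sub>w e\<^sub>u\<^sub>2 f\<^sub>v\<^sub>3 \<cdots>\<close> with \<open>w = \<gamma>\<inverse>(v\<^sub>1)\<close>. Further exchanges show that \<open>x\<close> also begins with \<open>e\<^sub>w\<close>
and that \<open>y\<close> also begins with \<open>f\<^sub>v\<^sub>1\<close>. So \<open>x\<close> and \<open>y\<close> have the same first \<open>e\<close> and the same first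
\<open>f\<close>.\<close>

lemma universal_period_of_exchange:
  assumes "exchange a b \<gamma>" "a > 0" "b > 0" "m \<ge> 1" "n \<ge> 1"
  shows "universal_period (int a) (- int b)"
  unfolding universal_period_def
proof (intro allI impI)
  fix P c R Q c' R'
  assume PW: "P @ c # R \<in> W" and PQ: "P @ c # R \<approx> Q @ c' # R'" and kind: "is_e c = is_e c'"
    and "int (num True P) = int (num True Q) + int a"
    and "int (num False P) = int (num False Q) + - int b"
  then have nP: "num True P = num True Q + a" and nQ: "num False Q = num False P + b" by auto
  have QW: "Q @ c' # R' \<in> W" using PW W_cong[OF PQ] by simp
  let ?\<delta> = "inv_into (words m a) \<gamma>"
  have bij: "bij_betw \<gamma> (words m a) (words n b)"
    using assms(1) by (simp add: exchange_def)
  have ex: "map E u @ map F v \<approx> map F (\<gamma> u) @ map E (?\<delta> v)"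
    if "u \<in> words m a" "v \<in> words n b" for u v
    using assms(1) that by (simp add: exchange_def)
  have g: "\<gamma> u \<in> words n b" "?\<delta> (\<gamma> u) = u" if "u \<in> words m a" for u
    using that bij by (auto simp: bij_betw_def)
  have d: "?\<delta> v \<in> words m a" "\<gamma> (?\<delta> v) = v" if "v \<in> words n b" for v
    using that bij by (auto simp: bij_betw_def inv_into_into f_inv_into_f)
  let ?pat = "replicate (num True Q) True @ replicate (num False P) False"
  have "count_list ?pat d + count_list (replicate a True) d = num d (P @ [])" for d
    using nP by (cases d) (simp_all add: count_list_replicate_bool)
  then obtain P1 U where P1: "P1 \<in> W" "U \<in> W" "P \<approx> P1 @ U" "kinds P1 = ?pat"
    and "kinds U = replicate a True"
    using factor_pattern_append[of P ?pat "replicate a True"] PW by auto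
  with P1(2) have "U \<in> block True a" by (simp add: block_def)
  then obtain u where u: "u \<in> words m a" "U = map E u" unfolding block_E by blast
  have "count_list ?pat d + count_list (replicate b False) d = num d (Q @ [])" for d
    using nQ by (cases d) (simp_all add: count_list_replicate_bool)
  then obtain Q1 V where Q1: "Q1 \<in> W" "V \<in> W" "Q \<approx> Q1 @ V" "kinds Q1 = ?pat"
    and "kinds V = replicate b False"
    using factor_pattern_append[of Q ?pat "replicate b False"] QW by auto
  with Q1(2) have "V \<in> block False b" by (simp add: block_def)
  then obtain v where v: "v \<in> words n b" "V = map F v" unfolding block_F by blast
  have "P1 @ (U @ c # R) \<approx> P @ c # R" using cong_appendR[OF cong_sym[OF P1(3)]] by simp
  also note PQ
  also have "Q @ c' # R' \<approx> Q1 @ (V @ c' # R')" using cong_appendR[OF Q1(3)] by simp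
  finally have UV: "map E u @ c # R \<approx> map F v @ c' # R'"
    using cong_cancel(2)[of P1 _ Q1] P1 Q1 u v by simp
  (* Enough letters for the blocks f_v1, e_u2 and f_v3. *)
  let ?z = "replicate a (E 1) @ replicate (b + b) (F 1)"
  have zW: "?z \<in> W" using assms by auto
  let ?rest = "c # R @ ?z"
  obtain v1 u2 v3 Y where f: "v1 \<in> words n b" "u2 \<in> words m a" "v3 \<in> words n b"
    "?rest \<approx> map F v1 @ map E u2 @ map F v3 @ Y"
  proof -
    let ?p1 = "replicate b False" and ?p2 = "replicate a True"
    let ?p = "?p1 @ ?p2 @ ?p1"
    have count: "count_list ?p d + count_list (kinds (c # R)) d = num d ?rest" for d
      by (cases d) (simp_all add: count_list_replicate_bool)
    have "?rest \<in> W" using PW zW by simp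
    then obtain X Y where XY: "X \<in> W" "Y \<in> W" "?rest \<approx> X @ Y" "kinds X = ?p"
      "kinds Y = kinds (c # R)"
      by (rule factor_pattern_append[OF _ count])
    from map_eq_append_conv[THEN iffD1, OF XY(4)]
    obtain V1 X2 where X: "X = V1 @ X2" "?p1 = kinds V1" "?p2 @ ?p1 = kinds X2"
      by blast
    from map_eq_append_conv[THEN iffD1, OF X(3)[symmetric]]
    obtain U2 V3 where "X2 = U2 @ V3" "?p2 = kinds U2" "?p1 = kinds V3"
      by blast
    then have "V1 \<in> block False b" "U2 \<in> block True a" "V3 \<in> block False b" "X = V1 @ U2 @ V3"
      using XY(1) X(1,2) by (auto simp: block_def)
    then show ?thesis using that XY(3) unfolding block_E block_F by auto
  qed
  let ?X = "map E u2 @ map F v3 @ Y"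
  have "map F v @ c' # R' @ ?z \<approx> map E u @ ?rest"
    using cong_appendR[OF cong_sym[OF UV], of ?z] by simp
  also have "\<dots> \<approx> map E u @ map F v1 @ ?X"
    using cong_appendL[OF f(4)] by simp
  also have "\<dots> \<approx> map F (\<gamma> u) @ map E (?\<delta> v1) @ ?X"
    using cong_appendR[OF ex[OF u(1) f(1)]] by simp
  finally have "map F v @ c' # R' @ ?z \<approx> map F (\<gamma> u) @ map E (?\<delta> v1) @ ?X" .
  moreover have "map F v \<in> block False b" "map F (\<gamma> u) \<in> block False b"
    using v(1) g(1)[OF u(1)] block_F by auto
  ultimately have c': "c' # R' @ ?z \<approx> map E (?\<delta> v1) @ ?X"
    using cong_cancel(2)[of "map F v" _ "map F (\<gamma> u)"] by (simp add: block_def)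
  have ne: "w \<noteq> []" if "w \<in> words k a \<or> w \<in> words k b" for w k
    using that assms by (auto simp: words_def)
  show "c = c'"
  proof (cases "is_e c")
    case True
    have "?rest \<approx> map F (\<gamma> (?\<delta> v1)) @ map E (?\<delta> (\<gamma> u2)) @ map F v3 @ Y"
      using f(4) d(2)[OF f(1)] g(2)[OF f(2)] by simp
    also have "\<dots> \<approx> map E (?\<delta> v1) @ map F (\<gamma> u2) @ map F v3 @ Y"
      using cong_appendR[OF cong_sym[OF ex[OF d(1)[OF f(1)] g(1)[OF f(2)]]]] by simp
    finally have c: "?rest \<approx> map E (?\<delta> v1) @ map F (\<gamma> u2) @ map F v3 @ Y" .
    have "map E (?\<delta> v1) \<noteq> []" "is_e (hd (map E (?\<delta> v1)))"
      using ne[of "?\<delta> v1" m] d(1)[OF f(1)] by (simp_all add: hd_map)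
    then show ?thesis using head_eq[OF c] head_eq[OF c'] True kind by auto
  next
    case False
    have "c' # R' @ ?z \<approx> map E (?\<delta> v1) @ map F (\<gamma> u2) @ map E (?\<delta> v3) @ Y"
      using cong_trans[OF c'] cong_appendL[OF cong_appendR[OF ex[OF f(2,3)]]] by simp
    also have "\<dots> \<approx> map F (\<gamma> (?\<delta> v1)) @ map E (?\<delta> (\<gamma> u2)) @ map E (?\<delta> v3) @ Y"
      using cong_appendR[OF ex[OF d(1)[OF f(1)] g(1)[OF f(2)]]] by simp
    also have "\<dots> = map F v1 @ map E u2 @ map E (?\<delta> v3) @ Y"
      using d(2)[OF f(1)] g(2)[OF f(2)] by simp
    finally have c'': "c' # R' @ ?z \<approx> map F v1 @ map E u2 @ map E (?\<delta> v3) @ Y" .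
    have "map F v1 \<noteq> []" "\<not> is_e (hd (map F v1))"
      using ne[of v1 n] f(1) by (simp_all add: hd_map)
    then show ?thesis using head_eq[OF f(4)] head_eq[OF c''] False kind by auto
  qed
qed

section \<open>Letters of a tail\<close>

definition interleave :: "(nat \<times> nat) list \<Rightarrow> letter list" where
  "interleave B = concat (map (\<lambda>(i, j). [E i, F j]) B)"

lemma interleave_simps [simp]:
  "interleave [] = []"
  "interleave (p # B) = E (fst p) # F (snd p) # interleave B"
  "interleave (B @ C) = interleave B @ interleave C"
  by (simp_all add: interleave_def case_prod_beta)

lemma num_interleave [simp]: "num c (interleave B) = length B"
  by (induction B) auto

lemma interleave_W: "B \<in> lists ({1..m} \<times> {1..n}) \<Longrightarrow> interleave B \<in> W"
  by (induction B) auto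

lemma interleave_of_kinds:
  assumes "w \<in> W" "kinds w = concat (replicate k [True, False])"
  shows "\<exists>B\<in>lists ({1..m} \<times> {1..n}). w = interleave B"
  using assms
proof (induction k arbitrary: w)
  case 0
  then show ?case by (intro bexI[of _ "[]"]) auto
next
  case (Suc k)
  then obtain x y w' where w: "w = x # y # w'" "is_e x" "\<not> is_e y"
    "kinds w' = concat (replicate k [True, False])"
    by (auto simp: map_eq_Cons_conv)
  then obtain i j where ij: "x = E i" "y = F j" by (metis is_e.simps letter.exhaust)
  obtain B where "B \<in> lists ({1..m} \<times> {1..n})" "w' = interleave B"
    using Suc.IH[of w'] Suc.prems w by auto
  then show ?case using w ij Suc.prems by (intro bexI[of _ "(i, j) # B"]) auto
qed

lemma cong_interleave:
  assumes "w \<in> W" "num True w = num False w"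
  obtains B where "B \<in> lists ({1..m} \<times> {1..n})" "w \<approx> interleave B"
proof -
  have "count_list (concat (replicate k [True, False])) c = k" for k c
    by (induction k; cases c) simp_all
  then have "count_list (concat (replicate (num True w) [True, False])) c = num c w" for c
    using assms(2) by (cases c) auto
  then obtain w' where "w' \<in> W" "w \<approx> w'" "kinds w' = concat (replicate (num True w) [True, False])"
    using factor_pattern[OF assms(1)] by blast
  then show ?thesis using that interleave_of_kinds by metis
qed

lemma tail_prefix_cls: "tail_prefix m n \<theta> \<tau> T = cls (interleave (map \<tau> [0..<T]))"
proof (induction T)
  case 0
  then show ?case by (simp add: theta_semigroup_def)
next
  case (Suc T)
  then show ?case by (simp add: gen_e_def gen_f_def mult_class)
qed

lemma tail_interleave_W:
  assumes "is_tail m n \<tau>"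
  shows "interleave (map \<tau> ks) \<in> W"
proof (rule interleave_W)
  show "map \<tau> ks \<in> lists ({1..m} \<times> {1..n})"
    using assms unfolding is_tail_def by (induction ks) simp_all
qed

text \<open>The labels \<open>i\<^sub>s\<^sub>,\<^sub>t\<close> and \<open>j\<^sub>s\<^sub>,\<^sub>t\<close> are the unique letters \<open>E i\<close> and \<open>F j\<close> that the tail has at position
\<open>(\<bar>s\<bar>, \<bar>t\<bar>)\<close>. The two kinds are again treated separately.\<close>

definition tail_has :: "(nat \<Rightarrow> nat \<times> nat) \<Rightarrow> nat \<Rightarrow> nat \<Rightarrow> letter \<Rightarrow> bool" where
  "tail_has \<tau> k l a \<longleftrightarrow> (\<exists>T P R. P @ a # R \<in> W \<and> interleave (map \<tau> [0..<T]) \<approx> P @ a # R \<and>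
    num True P = k \<and> num False P = l)"

lemma tail_prefix_extend:
  assumes "is_tail m n \<tau>" "T \<le> T'"
  obtains z where "z \<in> W" "interleave (map \<tau> [0..<T']) = interleave (map \<tau> [0..<T]) @ z"
proof -
  have "[0..<T'] = [0..<T] @ [T..<T']" using assms(2) by (metis le0 le_add_diff_inverse upt_add_eq_append)
  moreover have "interleave (map \<tau> [T..<T']) \<in> W"
    by (rule tail_interleave_W[OF assms(1)])
  ultimately show ?thesis using that by simp
qed

text \<open>Two letters of a tail that are witnessed in prefixes of different lengths are both found in the
longer prefix. Uniqueness of labels and the passage from universal periods to symmetries of tails
both compare letters in this way.\<close>

lemma tail_has_common:
  assumes "is_tail m n \<tau>" "tail_has \<tau> k l a" "tail_has \<tau> k' l' b"
  obtains P R Q R' where "P @ a # R \<in> W" "P @ a # R \<approx> Q @ b # R'"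
    "num True P = k" "num False P = l" "num True Q = k'" "num False Q = l'"
proof -
  obtain T P R where P: "P @ a # R \<in> W" "interleave (map \<tau> [0..<T]) \<approx> P @ a # R"
    "num True P = k" "num False P = l"
    using assms(2) unfolding tail_has_def by blast
  obtain T' Q R' where Q: "interleave (map \<tau> [0..<T']) \<approx> Q @ b # R'"
    "num True Q = k'" "num False Q = l'"
    using assms(3) unfolding tail_has_def by blast
  obtain z where z: "z \<in> W"
    "interleave (map \<tau> [0..<max T T']) = interleave (map \<tau> [0..<T]) @ z"
    by (rule tail_prefix_extend[OF assms(1) max.cobounded1])
  obtain z' where z': "z' \<in> W"
    "interleave (map \<tau> [0..<max T T']) = interleave (map \<tau> [0..<T']) @ z'"
    by (rule tail_prefix_extend[OF assms(1) max.cobounded2])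
  have "P @ a # R @ z \<approx> interleave (map \<tau> [0..<max T T'])"
    using cong_appendR[OF cong_sym[OF P(2)], of z] z by simp
  also have "\<dots> \<approx> Q @ b # R' @ z'"
    using cong_appendR[OF Q(1), of z'] z' by simp
  finally show ?thesis using that[of P "R @ z" Q "R' @ z'"] P Q z by simp
qed

lemma tail_has_unique:
  assumes "is_tail m n \<tau>" "tail_has \<tau> k l a" "tail_has \<tau> k l b" "is_e a = is_e b"
  shows "a = b"
proof -
  obtain P R Q R' where *: "P @ a # R \<in> W" "P @ a # R \<approx> Q @ b # R'"
    "num True P = k" "num False P = l" "num True Q = k" "num False Q = l"
    by (rule tail_has_common[OF assms(1-3)])
  have "num c P = num c Q" for c using * by (cases c) auto
  then have "a # R \<approx> b # R'"
    using cong_cancel(2)[OF *(2)] *(1) W_cong[OF *(2)] by simp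
  then show ?thesis using cong_ConsD(1) assms(4) by blast
qed

lemma carrier_cls: "X \<in> carrier (theta_semigroup m n \<theta>) \<longleftrightarrow> (\<exists>x\<in>W. X = cls x)"
  by (auto simp: theta_semigroup_def quotient_def)

lemma tail_label_has:
  assumes "is_tail m n \<tau>"
  shows "tail_has \<tau> (nat \<bar>s\<bar>) (nat \<bar>t\<bar>) (E (fst (tail_label m n \<theta> \<tau> s t)))"
    "tail_has \<tau> (nat \<bar>s\<bar>) (nat \<bar>t\<bar>) (F (snd (tail_label m n \<theta> \<tau> s t)))"
proof -
  let ?G = "theta_semigroup m n \<theta>"
  let ?\<Phi> = "\<lambda>ij. \<exists>T w1 w2 w' w''. int T > max \<bar>s\<bar> \<bar>t\<bar>
      \<and> w1 \<in> carrier ?G \<and> w2 \<in> carrier ?G \<and> w' \<in> carrier ?G \<and> w'' \<in> carrier ?G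
      \<and> tail_prefix m n \<theta> \<tau> T = w1 \<otimes>\<^bsub>?G\<^esub> w2
      \<and> degree w1 = (nat \<bar>s\<bar>, nat \<bar>t\<bar>)
      \<and> fst ij \<in> {1..m} \<and> snd ij \<in> {1..n}
      \<and> w2 = gen_e m n \<theta> (fst ij) \<otimes>\<^bsub>?G\<^esub> w'
      \<and> w2 = gen_f m n \<theta> (snd ij) \<otimes>\<^bsub>?G\<^esub> w''"
  have has: "tail_has \<tau> (nat \<bar>s\<bar>) (nat \<bar>t\<bar>) (E (fst ij)) \<and> tail_has \<tau> (nat \<bar>s\<bar>) (nat \<bar>t\<bar>) (F (snd ij))"
    if "?\<Phi> ij" for ij
  proof -
    from that obtain T w1 w2 w' w'' where
      *: "w1 \<in> carrier ?G" "w2 \<in> carrier ?G" "w' \<in> carrier ?G" "w'' \<in> carrier ?G"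
      "tail_prefix m n \<theta> \<tau> T = w1 \<otimes>\<^bsub>?G\<^esub> w2" "degree w1 = (nat \<bar>s\<bar>, nat \<bar>t\<bar>)"
      "w2 = gen_e m n \<theta> (fst ij) \<otimes>\<^bsub>?G\<^esub> w'" "w2 = gen_f m n \<theta> (snd ij) \<otimes>\<^bsub>?G\<^esub> w''"
      by blast
    obtain x1 x2 x' x'' where x: "x1 \<in> W" "x2 \<in> W" "w1 = cls x1" "w2 = cls x2" "w' = cls x'"
      "w'' = cls x''"
      using *(1-4) unfolding carrier_cls by blast
    let ?w = "interleave (map \<tau> [0..<T])"
    have w: "?w \<approx> x1 @ x2"
      using *(5) x by (simp add: tail_prefix_cls mult_class cls_eq_iff)
    have e: "x2 \<approx> E (fst ij) # x'"
      using *(7) unfolding x(4,5) gen_e_def mult_class cls_eq_iff by simp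
    have f: "x2 \<approx> F (snd ij) # x''"
      using *(8) unfolding x(4,6) gen_f_def mult_class cls_eq_iff by simp
    have n: "num True x1 = nat \<bar>s\<bar>" "num False x1 = nat \<bar>t\<bar>"
      using *(6) x by (simp_all add: degree_class word_degree_num)
    have "?w \<approx> x1 @ E (fst ij) # x'" "?w \<approx> x1 @ F (snd ij) # x''"
      using cong_trans[OF w cong_appendL[OF e]] cong_trans[OF w cong_appendL[OF f]] .
    moreover have "x1 @ E (fst ij) # x' \<in> W" "x1 @ F (snd ij) # x'' \<in> W"
      using W_cong[OF e] W_cong[OF f] x by simp_all
    ultimately show ?thesis using n unfolding tail_has_def by blast
  qed
  have "\<exists>ij. ?\<Phi> ij"
  proof -
    let ?k = "nat \<bar>s\<bar>" and ?l = "nat \<bar>t\<bar>"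
    let ?T = "Suc (max ?k ?l)"
    let ?w = "interleave (map \<tau> [0..<?T])"
    have W: "?w \<in> W" by (rule tail_interleave_W[OF assms])
    have le: "(if c then ?k else ?l) \<le> num c ?w" for c
      unfolding num_interleave by (cases c) (simp_all add: le_SucI)
    obtain x1 x2 where x: "x1 \<in> W" "x2 \<in> W" "?w \<approx> x1 @ x2"
      "\<And>c. num c x1 = (if c then ?k else ?l)"
      using factor_prefix[OF W, of "\<lambda>c. if c then ?k else ?l", OF le] by blast
    have "num c x2 > 0" for c
    proof -
      have "num c x1 + num c x2 = ?T"
        using num_cong[OF x(3), of c] unfolding num_interleave by simp
      then show ?thesis using x(4)[of c] by (simp split: if_splits)
    qed
    note pos = this
    obtain e x' where e: "e # x' \<in> W" "is_e e = True" "x2 \<approx> e # x'"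
      by (rule to_front[OF x(2) pos])
    obtain f x'' where f: "f # x'' \<in> W" "is_e f = False" "x2 \<approx> f # x''"
      by (rule to_front[OF x(2) pos])
    obtain i j where ij: "e = E i" "f = F j" using e f by (metis is_e.simps letter.exhaust)
    have "?\<Phi> (i, j)"
    proof (intro exI conjI)
      show "max \<bar>s\<bar> \<bar>t\<bar> < int ?T" by linarith
      show "tail_prefix m n \<theta> \<tau> ?T = cls x1 \<otimes>\<^bsub>?G\<^esub> cls x2"
        using x(3) by (simp only: tail_prefix_cls mult_class cls_eq_iff)
      show "degree (cls x1) = (?k, ?l)"
        unfolding degree_class word_degree_num x(4) by simp
      show "cls x2 = gen_e m n \<theta> (fst (i, j)) \<otimes>\<^bsub>?G\<^esub> cls x'"
        "cls x2 = gen_f m n \<theta> (snd (i, j)) \<otimes>\<^bsub>?G\<^esub> cls x''"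
        using e(3) f(3) ij by (simp_all add: gen_e_def gen_f_def mult_class cls_eq_iff)
      show "cls x1 \<in> carrier ?G" "cls x2 \<in> carrier ?G" "cls x' \<in> carrier ?G" "cls x'' \<in> carrier ?G"
        using x(1,2) e(1) f(1) unfolding carrier_cls by auto
      show "fst (i, j) \<in> {1..m}" "snd (i, j) \<in> {1..n}"
        using e(1) f(1) ij by simp_all
    qed
    then show ?thesis by blast
  qed
  then obtain ij where ij: "?\<Phi> ij" by blast
  have "ij' = ij" if "?\<Phi> ij'" for ij'
    using tail_has_unique[OF assms] has[OF that] has[OF ij] by (metis is_e.simps letter.inject prod_eqI)
  then have "tail_label m n \<theta> \<tau> s t = ij"
    unfolding tail_label_def using ij by (intro the_equality)
  then show "tail_has \<tau> (nat \<bar>s\<bar>) (nat \<bar>t\<bar>) (E (fst (tail_label m n \<theta> \<tau> s t)))"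
    "tail_has \<tau> (nat \<bar>s\<bar>) (nat \<bar>t\<bar>) (F (snd (tail_label m n \<theta> \<tau> s t)))"
    using has[OF ij] by simp_all
qed

lemma universal_period_tail_symmetry:
  assumes "universal_period p q" "is_tail m n \<tau>"
  shows "(p, q) \<in> tail_symmetry m n \<theta> \<tau>"
proof -
  let ?T = "- (\<bar>p\<bar> + \<bar>q\<bar>)"
  have eq: "a = b"
    if st: "s \<le> ?T" "t \<le> ?T" and ab: "tail_has \<tau> (nat \<bar>s + p\<bar>) (nat \<bar>t + q\<bar>) a" "tail_has \<tau> (nat \<bar>s\<bar>) (nat \<bar>t\<bar>) b"
      and kind: "is_e a = is_e b" for s t a b
  proof -
    obtain P R Q R' where *: "P @ b # R \<in> W" "P @ b # R \<approx> Q @ a # R'"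
      "num True P = nat \<bar>s\<bar>" "num False P = nat \<bar>t\<bar>"
      "num True Q = nat \<bar>s + p\<bar>" "num False Q = nat \<bar>t + q\<bar>"
      by (rule tail_has_common[OF assms(2) ab(2,1)])
    have "int (nat \<bar>s\<bar>) = int (nat \<bar>s + p\<bar>) + p" "int (nat \<bar>t\<bar>) = int (nat \<bar>t + q\<bar>) + q"
      using st by linarith+
    then have "b = a"
      by (intro universal_periodD[OF assms(1) *(2,1)]) (use kind *(3-6) in \<open>simp_all only:\<close>)
    then show ?thesis by simp
  qed
  have "tail_label m n \<theta> \<tau> (s + p) (t + q) = tail_label m n \<theta> \<tau> s t" if st: "s \<le> ?T" "t \<le> ?T" for s t
  proof (rule prod_eqI)
    show "fst (tail_label m n \<theta> \<tau> (s + p) (t + q)) = fst (tail_label m n \<theta> \<tau> s t)"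
      using eq[OF st tail_label_has(1)[OF assms(2)] tail_label_has(1)[OF assms(2)]] by simp
    show "snd (tail_label m n \<theta> \<tau> (s + p) (t + q)) = snd (tail_label m n \<theta> \<tau> s t)"
      using eq[OF st tail_label_has(2)[OF assms(2)] tail_label_has(2)[OF assms(2)]] by simp
  qed
  then show ?thesis
    unfolding tail_symmetry_def by (auto intro!: exI[of _ ?T])
qed

end

section \<open>A tail that contains every element\<close>

text \<open>Concatenating all finite lists over \<open>A\<close> gives a sequence in which every list occurs; the additional
letter \<open>a\<close> in front of each list guarantees that the concatenation is infinite. A list occurs beyond
any given \<open>N\<close> because the same list with a prefix of length \<open>N\<close> occurs.\<close>

lemma ex_disjunctive_sequence:
  fixes A :: "'a :: countable set"
  assumes "a \<in> A"
  shows "\<exists>\<tau> :: nat \<Rightarrow> 'a. range \<tau> \<subseteq> A \<and>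
    (\<forall>xs\<in>lists A. \<forall>N. \<exists>M\<ge>N. map \<tau> [M..<M + length xs] = xs)"
proof -
  define B where "B k = a # (let xs = from_nat k in if xs \<in> lists A then xs else [])" for k :: nat
  define P where "P k = concat (map B [0..<k])" for k
  have BA: "B k \<in> lists A" for k
    using assms by (simp add: B_def Let_def)
  have PSuc: "P (Suc k) = P k @ B k" for k
    by (simp add: P_def)
  have len: "k \<le> length (P k)" for k
    by (induction k) (auto simp: PSuc B_def)
  have PA: "P k \<in> lists A" for k
    using BA by (induction k) (simp_all add: PSuc, simp add: P_def)
  have mono: "\<exists>ys. P l = P k @ ys" if "k \<le> l" for k l
    using that by (induction l rule: dec_induct) (auto simp: PSuc)
  define \<tau> where "\<tau> i = P (Suc i) ! i" for i
  have \<tau>: "\<tau> i = P k ! i" if "i < length (P k)" for i k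
  proof -
    have i: "i < length (P (Suc i))" using len[of "Suc i"] by simp
    consider "k \<le> Suc i" | "Suc i \<le> k" by linarith
    then show ?thesis
    proof cases
      case 1
      then show ?thesis using mono[OF 1] that by (auto simp: \<tau>_def nth_append)
    next
      case 2
      then show ?thesis using mono[OF 2] i by (auto simp: \<tau>_def nth_append)
    qed
  qed
  have occurs: "\<exists>M. map \<tau> [M..<M + length xs] = xs" if "xs \<in> lists A" for xs
  proof -
    let ?k = "to_nat xs"
    have "B ?k = a # xs" using that by (simp add: B_def)
    then have P: "P (Suc ?k) = (P ?k @ [a]) @ xs" by (simp add: PSuc)
    let ?M = "length (P ?k @ [a])"
    have "\<tau> (?M + i) = xs ! i" if "i < length xs" for i
      using \<tau>[of "?M + i" "Suc ?k"] that unfolding P nth_append_length_plus by simp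
    then have "map \<tau> [?M..<?M + length xs] = xs"
      by (intro map_upt_eqI) simp_all
    then show ?thesis by blast
  qed
  have "range \<tau> \<subseteq> A"
  proof clarify
    fix i
    have "i < length (P (Suc i))" using len[of "Suc i"] by simp
    then show "\<tau> i \<in> A" unfolding \<tau>_def using PA[of "Suc i"] by (metis in_listsD nth_mem)
  qed
  moreover have "\<exists>M\<ge>N. map \<tau> [M..<M + length xs] = xs" if xs: "xs \<in> lists A" for xs N
  proof -
    have "replicate N a @ xs \<in> lists A" using xs assms by auto
    from occurs[OF this] obtain M where M: "map \<tau> [M..<M + (N + length xs)] = replicate N a @ xs"
      by auto
    have "[M..<M + (N + length xs)] = [M..<M + N] @ [M + N..<M + N + length xs]"
      by (metis add.assoc le_add1 upt_add_eq_append)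
    then have "map \<tau> [M + N..<M + N + length xs] = xs" using M by simp
    then show ?thesis by (intro exI[of _ "M + N"]) simp
  qed
  ultimately show ?thesis by blast
qed

context theta_words
begin

lemma ex_tail_symmetry_universal_period:
  assumes "m \<ge> 1" "n \<ge> 1"
  shows "\<exists>\<tau>. is_tail m n \<tau> \<and> (\<forall>(p, q)\<in>tail_symmetry m n \<theta> \<tau>. universal_period p q)"
proof -
  have "(1, 1) \<in> {1..m} \<times> {1..n}" using assms by auto
  from ex_disjunctive_sequence[OF this]
  obtain \<tau> where range: "range \<tau> \<subseteq> {1..m} \<times> {1..n}"
    and rich: "\<forall>xs\<in>lists ({1..m} \<times> {1..n}). \<forall>N. \<exists>M\<ge>N. map \<tau> [M..<M + length xs] = xs"
    by (elim exE conjE)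
  have tail: "is_tail m n \<tau>" using range unfolding is_tail_def by blast
  have "universal_period p q" if pq: "(p, q) \<in> tail_symmetry m n \<theta> \<tau>" for p q
    unfolding universal_period_def
  proof (intro allI impI)
    fix P c R Q c' R'
    assume PW: "P @ c # R \<in> W" and PQ: "P @ c # R \<approx> Q @ c' # R'" and kind: "is_e c = is_e c'"
      and p: "int (num True P) = int (num True Q) + p"
      and q: "int (num False P) = int (num False Q) + q"
    from pq obtain T where T: "\<forall>s\<le>T. \<forall>t\<le>T.
        tail_label m n \<theta> \<tau> (s + p) (t + q) = tail_label m n \<theta> \<tau> s t"
      unfolding tail_symmetry_def by blast
    let ?x = "P @ c # R"
    (* This factor makes the degree of the element square, so that it can be written in the
       alternating form of a tail. *)
    let ?z = "replicate (num False ?x) (E 1) @ replicate (num True ?x) (F 1)"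
    have zW: "?z \<in> W" using assms by auto
    have "num True (?x @ ?z) = num False (?x @ ?z)"
      by (simp add: count_list_replicate_bool)
    moreover have "?x @ ?z \<in> W" using PW zW by simp
    ultimately obtain B where B: "B \<in> lists ({1..m} \<times> {1..n})" "?x @ ?z \<approx> interleave B"
      by (metis cong_interleave)
    obtain M where M: "M \<ge> nat (- T)" "map \<tau> [M..<M + length B] = B"
      using rich B(1) by blast
    let ?w = "interleave (map \<tau> [0..<M])"
    have wW: "?w \<in> W" by (rule tail_interleave_W[OF tail])
    have "[0..<M + length B] = [0..<M] @ [M..<M + length B]"
      by (rule upt_add_eq_append) simp
    then have wB: "interleave (map \<tau> [0..<M + length B]) = ?w @ interleave B"
      using M(2) by simp
    have wP: "interleave (map \<tau> [0..<M + length B]) \<approx> (?w @ P) @ c # R @ ?z"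
      unfolding wB using cong_appendL[OF cong_sym[OF B(2)], of ?w] by simp
    have wQ: "interleave (map \<tau> [0..<M + length B]) \<approx> (?w @ Q) @ c' # R' @ ?z"
      using cong_trans[OF wP[simplified append_assoc]
          cong_appendL[OF cong_appendR[OF PQ, simplified append_assoc append_Cons]]]
      by (simp only: append_assoc append_Cons)
    have hasP: "tail_has \<tau> (M + num True P) (M + num False P) c"
      unfolding tail_has_def using wP PW zW wW
      by (intro exI[of _ "M + length B"] exI[of _ "?w @ P"] exI[of _ "R @ ?z"]) auto
    have hasQ: "tail_has \<tau> (M + num True Q) (M + num False Q) c'"
      unfolding tail_has_def using wQ PW W_cong[OF PQ] zW wW
      by (intro exI[of _ "M + length B"] exI[of _ "?w @ Q"] exI[of _ "R' @ ?z"]) auto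
    let ?s = "- int (M + num True P)" and ?t = "- int (M + num False P)"
    have "?s \<le> T" "?t \<le> T" using M(1) by linarith+
    then have lab: "tail_label m n \<theta> \<tau> (?s + p) (?t + q) = tail_label m n \<theta> \<tau> ?s ?t"
      using T by blast
    have "nat \<bar>?s\<bar> = M + num True P" "nat \<bar>?t\<bar> = M + num False P"
      "nat \<bar>?s + p\<bar> = M + num True Q" "nat \<bar>?t + q\<bar> = M + num False Q"
      using p q by linarith+
    note has = tail_label_has[OF tail, of ?s ?t, unfolded this]
      tail_label_has[OF tail, of "?s + p" "?t + q", unfolded this lab]
    show "c = c'"
    proof (cases "is_e c")
      case True
      then show ?thesis
        using tail_has_unique[OF tail hasP has(1)] tail_has_unique[OF tail hasQ has(3)] kind by simp
    next
      case False
      then show ?thesis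
        using tail_has_unique[OF tail hasP has(2)] tail_has_unique[OF tail hasQ has(4)] kind by simp
    qed
  qed
  then show ?thesis using tail by blast
qed

section \<open>The aperiodicity criterion\<close>

lemma aperiodicity_iff_no_universal_period:
  assumes "m \<ge> 1" "n \<ge> 1"
  shows "aperiodicity_condition m n \<theta> \<longleftrightarrow> (\<forall>p q. universal_period p q \<longrightarrow> p = 0 \<and> q = 0)"
proof
  assume "aperiodicity_condition m n \<theta>"
  then show "\<forall>p q. universal_period p q \<longrightarrow> p = 0 \<and> q = 0"
    using universal_period_tail_symmetry
    unfolding aperiodicity_condition_def aperiodic_tail_def by fastforce
next
  assume none: "\<forall>p q. universal_period p q \<longrightarrow> p = 0 \<and> q = 0"
  obtain \<tau> where \<tau>: "is_tail m n \<tau>"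
    "\<And>p q. (p, q) \<in> tail_symmetry m n \<theta> \<tau> \<Longrightarrow> universal_period p q"
    using ex_tail_symmetry_universal_period[OF assms] by blast
  moreover have "(0, 0) \<in> tail_symmetry m n \<theta> \<tau>"
    by (auto simp: tail_symmetry_def)
  ultimately have "tail_symmetry m n \<theta> \<tau> = {(0, 0)}" using none by auto
  then show "aperiodicity_condition m n \<theta>"
    using \<tau>(1) unfolding aperiodicity_condition_def aperiodic_tail_def by blast
qed

lemma no_universal_period_iff_no_exchange:
  assumes "m \<ge> 2" "n \<ge> 2"
  shows "(\<forall>p q. universal_period p q \<longrightarrow> p = 0 \<and> q = 0) \<longleftrightarrow>
    \<not> (\<exists>a b \<gamma>. a > 0 \<and> b > 0 \<and> exchange a b \<gamma>)"
proof -
  have mn: "m \<ge> 1" "n \<ge> 1" using assms by auto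
  have "\<exists>a b \<gamma>. a > 0 \<and> b > 0 \<and> exchange a b \<gamma>" if up: "universal_period p q" "\<not> (p = 0 \<and> q = 0)" for p q
  proof -
    note up' = universal_period_uminus[OF up(1)]
    have pq: "\<not> (p \<ge> 0 \<and> q \<ge> 0)" "\<not> (p \<le> 0 \<and> q \<le> 0)"
      using universal_period_nonneg[OF up(1) _ _ assms] universal_period_nonneg[OF up' _ _ assms] up(2)
      by auto
    consider "p > 0" "q < 0" | "p < 0" "q > 0" using pq by linarith
    then obtain a b :: nat where "a > 0" "b > 0" "universal_period (int a) (- int b)"
    proof cases
      case 1
      then show ?thesis using that[of "nat p" "nat (- q)"] up(1) by simp
    next
      case 2
      then show ?thesis using that[of "nat (- p)" "nat q"] up' by simp
    qed
    then show ?thesis using ex_exchange mn by blast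
  qed
  moreover have "universal_period (int a) (- int b)" if "a > 0" "b > 0" "exchange a b \<gamma>" for a b \<gamma>
    using universal_period_of_exchange that mn by blast
  ultimately show ?thesis by (metis of_nat_0_eq_iff less_irrefl)
qed

lemma e_word_cls: "e_word m n \<theta> u = cls (map E u)"
proof (induction u)
  case (Cons i u)
  then show ?case by (simp add: e_word_def gen_e_def mult_class)
qed (simp add: e_word_def theta_semigroup_def)

lemma f_word_cls: "f_word m n \<theta> v = cls (map F v)"
proof (induction v)
  case (Cons i u)
  then show ?case by (simp add: f_word_def gen_f_def mult_class)
qed (simp add: f_word_def theta_semigroup_def)

lemma card_words: "card (words k a) = k ^ a"
  using card_lists_length_eq[of "{1..k}" a] by (simp add: words_def conj_commute)

text \<open>The relation \<open>exchange\<close> speaks of words; this is its form in the semigroup itself. The equation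
\<open>m ^ a = n ^ b\<close> comes from counting words by means of the bijection.\<close>

lemma exchange_iff:
  "exchange a b \<gamma> \<longleftrightarrow> m ^ a = n ^ b \<and> bij_betw \<gamma> (words m a) (words n b) \<and>
    (\<forall>u\<in>words m a. \<forall>v\<in>words n b.
      e_word m n \<theta> u \<otimes>\<^bsub>theta_semigroup m n \<theta>\<^esub> f_word m n \<theta> v =
      f_word m n \<theta> (\<gamma> u) \<otimes>\<^bsub>theta_semigroup m n \<theta>\<^esub> e_word m n \<theta> (inv_into (words m a) \<gamma> v))"
  using bij_betw_same_card[of \<gamma> "words m a" "words n b"]
  by (auto simp: exchange_def e_word_cls f_word_cls mult_class cls_eq_iff card_words)

end

theorem theorem3p4:
  fixes m n :: nat and \<theta> :: "nat \<times> nat \<Rightarrow> nat \<times> nat"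
  assumes "m \<ge> 2" and "n \<ge> 2"
    and "\<theta> permutes ({1..m} \<times> {1..n})"
  shows "aperiodicity_condition m n \<theta> \<longleftrightarrow>
    \<not> (\<exists>a b. a > 0 \<and> b > 0 \<and> m ^ a = n ^ b \<and>
      (\<exists>\<gamma>. bij_betw \<gamma> (words m a) (words n b) \<and>
        (\<forall>u\<in>words m a. \<forall>v\<in>words n b.
          e_word m n \<theta> u \<otimes>\<^bsub>theta_semigroup m n \<theta>\<^esub> f_word m n \<theta> v =
          f_word m n \<theta> (\<gamma> u) \<otimes>\<^bsub>theta_semigroup m n \<theta>\<^esub>
            e_word m n \<theta> (inv_into (words m a) \<gamma> v))))"
proof -
  interpret theta_words m n \<theta>
    using assms(3) by unfold_locales
  have "aperiodicity_condition m n \<theta> \<longleftrightarrow> \<not> (\<exists>a b \<gamma>. a > 0 \<and> b > 0 \<and> exchange a b \<gamma>)"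
    using aperiodicity_iff_no_universal_period no_universal_period_iff_no_exchange assms(1,2)
    by simp
  then show ?thesis
    unfolding exchange_iff by blast
qed

end
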